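(* Let $n\ge2$ and let $(k_1,\alpha_1),\dots,(k_n,\alpha_n)$ be an admissible sequence with $k_i\ne k_j$ for all $i\neq j$ in $\{1,\dots,n\}$. Let $\Sigma_n\in\mathbb{R}^{n\times n}$ be the asymptotic covariance matrix, in the subcritical regime, of the vector of distinct $k_i$-simplices $(\tilde{\mathcal V}_{k_1}^{(\alpha_1)},\dots,\tilde{\mathcal V}_{k_n}^{(\alpha_n)})$. Then the following statements hold: (i) The determinant of $\Sigma_n$ is $$\det\Sigma_n=\prod_{i=1}^n\frac{\mu_{k_i}^{(2\alpha_i)}}{(k_i+1)!}.$$ (ii) The eigenvalues of $\Sigma_n$ are its diagonal entries $$\lambda_i=\frac{\mu_{k_i}^{(2\alpha_i)}}{(k_i+1)!},\qquad i=1,\dots,n.$$ (iii) The eigenspaces of $\Sigma_n$ are given by $$\mathrm{eig}(\lambda_i;\Sigma_n)=\langle e_i\rangle,\qquad i=1,\dots,n,$$ where $e_i$ denotes the $i$-th $n$-dimensional unit vector.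
   Context: Fix $d\ge 1$ and let $B^d\subset\mathbb{R}^d$ be the unit ball. For $s>0$ and points $x_0,\dots,x_k\in\mathbb{R}^d$ with $k\le d$, $\Delta_s[x_0,\dots,x_k]$ is the $k$-dimensional volume of the convex hull of $x_0,\dots,x_k$ if all edge lengths $\|x_i-x_j\|$ are at most $s$, and $0$ otherwise; for $k>d$ the volume is replaced by $1$. Powers $\Delta_s[\cdot]^\alpha$ are understood to be $0$ when some edge length exceeds $s$. Define $$\mu_k^{(\alpha)}=\int_{(B^d)^k}\Delta_1[0,x_1,\dots,x_k]^\alpha\,dx_1\cdots dx_k.$$ A sequence $(k_1,\alpha_1),\dots,(k_n,\alpha_n)$ (with $k_i$ integers, $\alpha_i$ real) is admissible if: $0\le k_1\le\dots\le k_n$; the pairs are distinct; $\alpha_i>-d+k_i-1$ and $\alpha_i+\alpha_j>-d+\min_{l\in\{i,j\}}k_l-1$ for all $i,j$; and $\alpha_i=0$ if $k_i>d$. Let $\eta_t$ be a homogeneous Poisson point process of intensity $t$ in a convex compact set $W\subset\mathbb{R}^d$ of volume $1$, and let $\delta_t\to0$ as $t\to\infty$. The volume power functional is $$\mathcal V_k^{(\alpha)}=\frac1{(k+1)!}\sum_{(x_0,\dots,x_k)}\Delta_{\delta_t}[x_0,\dots,x_k]^\alpha,$$ summed over all $(k+1)$-tuples of pairwise distinct points of $\eta_t$, and its normalized version is $\tilde{\mathcal V}_{k_i}^{(\alpha_i)}=\mathcal V_{k_i}^{(\alpha_i)}/Q_i$ with $Q_i=t^{1/2}\delta_t^{\alpha_ik_i}\max_{1\le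 m\le k_i+1}(t\delta_t^d)^{k_i-\frac{m-1}{2}}$. If the $k_i$ are pairwise different, $(\tilde{\mathcal V}_{k_1}^{(\alpha_1)},\dots,\tilde{\mathcal V}_{k_n}^{(\alpha_n)})$ is called the vector of distinct $k_i$-simplices. In the subcritical regime ($t\delta_t^d\to0$) the asymptotic covariance matrix of the normalized vector is $$\Sigma_n=\Big(\mu_{k_j}^{(\alpha_l+\alpha_j)}\frac{\mathbf 1(k_l=k_j)}{(k_j+1)!}\Big)_{l,j=1,\dots,n}.$$ Here $\mathrm{eig}(\lambda;\Sigma_n)$ denotes the eigenspace of $\Sigma_n$ for the eigenvalue $\lambda$, and $\langle\cdot\rangle$ denotes linear span.
   Formalization: Item (iii) fails if eigenvalues coincide (d=1, pairs (0,0),(1,0) give the identity matrix); it is proved for each i with λ_i different from all other λ_j, and in general the eigenspace is shown to be the span of all e_j with λ_j=λ_i. *)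

theory Defs
  imports
    "HOL-Analysis.Analysis"
    "Jordan_Normal_Form.Char_Poly"
    "Jordan_Normal_Form.VS_Connect"
begin

definition orthonormal_family :: "nat \<Rightarrow> (nat \<Rightarrow> 'a::real_inner) \<Rightarrow> bool" where
  "orthonormal_family k u \<longleftrightarrow> (\<forall>i<k. \<forall>j<k. inner (u i) (u j) = (if i = j then 1 else 0))"

definition isometric_chart :: "nat \<Rightarrow> ((nat \<Rightarrow> real) \<Rightarrow> 'a::real_inner) \<Rightarrow> bool" where
  "isometric_chart k f \<longleftrightarrow>
     (\<exists>p u. orthonormal_family k u \<and> f = (\<lambda>y. p + (\<Sum>i<k. y i *\<^sub>R u i)))"

text \<open>
  The \<open>k\<close>-dimensional volume of a set \<open>S\<close> lying in some \<open>k\<close>-dimensional affine flat: Lebesgue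
  measure of \<open>S\<close> in Cartesian coordinates of such a flat. As Lebesgue measure is invariant under
  rigid motions, the value does not depend on the chart that is selected; it is \<open>0\<close> if \<open>S\<close> lies in a
  flat of smaller dimension. For \<open>k = 0\<close> the volume of a point is \<open>1\<close>.
\<close>
definition flat_volume :: "nat \<Rightarrow> 'a::euclidean_space set \<Rightarrow> real" where
  "flat_volume k S =
     (let f = (SOME f. isometric_chart k f \<and> S \<subseteq> range f); M = Pi\<^sub>M {..<k} (\<lambda>_. lborel)
      in measure M (f -` S \<inter> space M))"

text \<open>
  The quantity \<open>\<Delta>\<^sub>s[x\<^sub>0, \<dots>, x\<^sub>k]\<close>, where only the values \<open>x 0, \<dots>, x k\<close> matter.
\<close>
definition simplex_volume :: "real \<Rightarrow> nat \<Rightarrow> (nat \<Rightarrow> 'a::euclidean_space) \<Rightarrow> real" where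
  "simplex_volume s k x =
     (if \<forall>i\<le>k. \<forall>j\<le>k. norm (x i - x j) \<le> s
      then (if k \<le> DIM('a) then flat_volume k (convex hull (x ` {..k})) else 1)
      else 0)"

text \<open>
  The moments \<open>\<mu>\<^sub>k\<close> with exponent \<open>a\<close> in dimension \<open>d = CARD('d)\<close>. Since \<open>0 powr a = 0\<close> for every
  real \<open>a\<close>, also for \<open>a \<le> 0\<close>, the power vanishes as soon as an edge is longer than \<open>1\<close>, as the
  convention for powers of \<open>\<Delta>\<^sub>1\<close> demands. The other configurations with \<open>\<Delta>\<^sub>1 = 0\<close> are degenerate
  simplices, which form a null set.
\<close>
definition simplex_moment :: "'d::finite itself \<Rightarrow> nat \<Rightarrow> real \<Rightarrow> real" where
  "simplex_moment _ k a =
     (LINT x : (\<Pi>\<^sub>E i\<in>{1..k}. cball 0 1) | Pi\<^sub>M {1..k} (\<lambda>_. lborel).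
        simplex_volume 1 k (x(0 := (0 :: real ^ 'd))) powr a)"

text \<open>
  Sequences of length \<open>n\<close> are indexed by \<open>0, \<dots>, n - 1\<close>, to agree with the indexing of matrices.
\<close>
definition admissible :: "nat \<Rightarrow> nat \<Rightarrow> (nat \<Rightarrow> nat) \<Rightarrow> (nat \<Rightarrow> real) \<Rightarrow> bool" where
  "admissible d n k \<alpha> \<longleftrightarrow>
     (\<forall>i<n. \<forall>j<n. i \<le> j \<longrightarrow> k i \<le> k j) \<and>
     inj_on (\<lambda>i. (k i, \<alpha> i)) {..<n} \<and>
     (\<forall>i<n. \<alpha> i > - real d + real (k i) - 1) \<and>
     (\<forall>i<n. \<forall>j<n. \<alpha> i + \<alpha> j > - real d + real (min (k i) (k j)) - 1) \<and>
     (\<forall>i<n. k i > d \<longrightarrow> \<alpha> i = 0)"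

text \<open>
  The asymptotic covariance matrix, in the subcritical regime, of the normalized vector of volume
  power functionals with parameters \<open>(k i, \<alpha> i)\<close> for \<open>i < n\<close>.
\<close>
definition subcritical_cov ::
    "'d::finite itself \<Rightarrow> nat \<Rightarrow> (nat \<Rightarrow> nat) \<Rightarrow> (nat \<Rightarrow> real) \<Rightarrow> real Matrix.mat" where
  "subcritical_cov D n k \<alpha> =
     Matrix.mat n n (\<lambda>(l, j). simplex_moment D (k j) (\<alpha> l + \<alpha> j) *
        (if k l = k j then 1 else 0) / fact (k j + 1))"

definition eigenspace :: "'a::comm_ring_1 \<Rightarrow> 'a Matrix.mat \<Rightarrow> 'a Matrix.vec set" where
  "eigenspace ev A = {v \<in> carrier_vec (dim_row A). A *\<^sub>v v = ev \<cdot>\<^sub>v v}"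

abbreviation vec_span :: "nat \<Rightarrow> 'a::field Matrix.vec set \<Rightarrow> 'a Matrix.vec set" where
  "vec_span n \<equiv> LinearCombinations.module.span class_ring (module_vec TYPE('a) n)"

end

theory Submission
  imports Defs
begin

text \<open>The indicator of \<open>k l = k j\<close> in the covariance matrix vanishes off the
  diagonal once the \<open>k i\<close> are pairwise different, so \<Sigma> is diagonal with entries
  \<open>ev i\<close> (\<open>subcritical_cov_eq_mat_diag\<close>), and the rest is linear algebra
  of diagonal matrices. Determinant and characteristic polynomial are products over the diagonal,
  and the roots of the latter are the eigenvalues. The eigenvalue equation decouples into
  \<open>(f j - x) * v $ j = 0\<close>, so an eigenspace consists of the vectors supported on the
  indices with \<open>f j = x\<close> (\<open>eigenspace_mat_diag\<close>), which is the span of the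
  corresponding unit vectors (\<open>span_unit_vecs\<close>). It is the line through a single unit
  vector exactly when that diagonal entry occurs once.\<close>

lemma mat_diag_index [simp]:
  "i < n \<Longrightarrow> j < n \<Longrightarrow> mat_diag n f $$ (i, j) = (if i = j then f j else 0)"
  by (simp add: mat_diag_def)

text \<open>Gives access to the product formulas for determinants and characteristic polynomials of
  triangular matrices.\<close>

lemma upper_triangular_mat_diag: "upper_triangular (mat_diag n f)"
  by (intro upper_triangularI) (auto simp: mat_diag_def)

lemma diag_mat_mat_diag: "diag_mat (mat_diag n f) = map f [0..<n]"
  by (auto simp: diag_mat_def mat_diag_def)

lemma det_mat_diag:
  fixes f :: "nat \<Rightarrow> 'a::comm_ring_1"
  shows "Determinant.det (mat_diag n f) = (\<Prod>i<n. f i)"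
  by (simp add: det_upper_triangular[OF upper_triangular_mat_diag mat_diag_dim]
      diag_mat_mat_diag prod.list_conv_set_nth atLeast0LessThan)

lemma char_poly_mat_diag:
  fixes f :: "nat \<Rightarrow> 'a::comm_ring_1"
  shows "char_poly (mat_diag n f) = (\<Prod>i<n. [:- f i, 1:])"
  by (simp add: char_poly_upper_triangular[OF mat_diag_dim upper_triangular_mat_diag]
      diag_mat_mat_diag prod.list_conv_set_nth atLeast0LessThan)

lemma eigenvalue_mat_diag_iff:
  fixes f :: "nat \<Rightarrow> 'a::field"
  shows "eigenvalue (mat_diag n f) x \<longleftrightarrow> x \<in> f ` {..<n}"
  by (auto simp: eigenvalue_root_char_poly[OF mat_diag_dim] char_poly_mat_diag poly_prod)

text \<open>Coordinatewise the equation is \<open>f j * v $ j = x * v $ j\<close>; without zero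
  divisors this forces \<open>v $ j = 0\<close> wherever \<open>f j\<close> differs from
  \<open>x\<close>.\<close>

lemma eigenspace_mat_diag:
  fixes f :: "nat \<Rightarrow> 'a::idom"
  shows "eigenspace x (mat_diag n f) =
    {v \<in> carrier_vec n. \<forall>j<n. f j \<noteq> x \<longrightarrow> v $ j = 0}"
proof -
  have "(mat_diag n f *\<^sub>v v) $ i = f i * v $ i" if "v \<in> carrier_vec n" "i < n" for v i
  proof -
    have "(mat_diag n f *\<^sub>v v) $ i = (\<Sum>j<n. (if i = j then f j else 0) * v $ j)"
      using that by (simp add: mat_diag_def scalar_prod_def atLeast0LessThan)
    also have "\<dots> = (\<Sum>j<n. if j = i then f i * v $ i else 0)"
      by (intro sum.cong) auto
    finally show ?thesis using that by simp
  qed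
  then have "mat_diag n f *\<^sub>v v = x \<cdot>\<^sub>v v \<longleftrightarrow> (\<forall>j<n. f j \<noteq> x \<longrightarrow> v $ j = 0)"
    if "v \<in> carrier_vec n" for v
    using that by (auto simp: Matrix.vec_eq_iff mat_diag_def)
  moreover have "dim_row (mat_diag n f) = n"
    by (simp add: mat_diag_def)
  ultimately show ?thesis
    by (auto simp: eigenspace_def)
qed

text \<open>The \<open>i\<close>-th coordinate of a combination of unit vectors is the coefficient
  of the \<open>i\<close>-th one, or 0 if that vector is absent.\<close>

lemma (in vec_space) span_unit_vecs:
  assumes "J \<subseteq> {..<n}"
  shows "span (unit_vec n ` J) = {v \<in> carrier_vec n. \<forall>i<n. i \<notin> J \<longrightarrow> v $ i = 0}"
    (is "span ?U = ?R")
proof -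
  have fin: "finite ?U"
    using assms finite_subset by blast
  have U: "?U \<subseteq> carrier_vec n"
    by auto
  \<comment> \<open>\<open>lincomb\<close> sums over a set of vectors; injectivity turns this into a
    sum over indices.\<close>
  have "inj_on (unit_vec n :: nat \<Rightarrow> 'a vec) J"
    using assms by (intro inj_onI) (metis lessThan_iff subsetD unit_vec_eq)
  then have idx: "lincomb a ?U $ i = (if i \<in> J then a (unit_vec n i) else 0)"
    if "i < n" for a i
  proof -
    have "lincomb a ?U $ i = (\<Sum>j\<in>J. a (unit_vec n j) * unit_vec n j $ i)"
      using \<open>inj_on _ J\<close> by (simp add: lincomb_index[OF that U] sum.reindex)
    also have "\<dots> = (\<Sum>j\<in>J. if j = i then a (unit_vec n i) else 0)"
      using that assms by (intro sum.cong) (auto simp: unit_vec_def)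
    also have "\<dots> = (if i \<in> J then a (unit_vec n i) else 0)"
      using assms finite_subset[of J "{..<n}"] by auto
    finally show ?thesis .
  qed
  show ?thesis
  proof (intro equalityI subsetI)
    fix v assume "v \<in> span ?U"
    then obtain a where "v = lincomb a ?U"
      using finite_span[OF fin U] by auto
    then show "v \<in> ?R"
      using idx U by auto
  next
    fix v assume v: "v \<in> ?R"
    \<comment> \<open>Coefficients are functions of the vector, not of its index; the scalar product
      with a unit vector reads off the coordinate of \<open>v\<close>.\<close>
    have "v = lincomb (\<lambda>u. v \<bullet> u) ?U"
    proof (rule eq_vecI)
      show "dim_vec v = dim_vec (lincomb (\<lambda>u. v \<bullet> u) ?U)"
        using v by (simp add: lincomb_dim[OF fin U])
      fix i assume "i < dim_vec (lincomb (\<lambda>u. v \<bullet> u) ?U)"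
      then show "v $ i = lincomb (\<lambda>u. v \<bullet> u) ?U $ i"
        using v by (auto simp: lincomb_dim[OF fin U] idx)
    qed
    then show "v \<in> span ?U"
      using finite_span[OF fin U] by auto
  qed
qed

lemma eigenspace_mat_diag_eq_span:
  fixes f :: "nat \<Rightarrow> 'a::field"
  shows "eigenspace x (mat_diag n f) = vec_span n {unit_vec n j |j. j < n \<and> f j = x}"
proof -
  let ?J = "{j. j < n \<and> f j = x}"
  have "vec_span n (unit_vec n ` ?J) = {v \<in> carrier_vec n. \<forall>i<n. i \<notin> ?J \<longrightarrow> v $ i = 0}"
    by (rule vec_space.span_unit_vecs) auto
  moreover have "{unit_vec n j :: 'a Matrix.vec |j. j < n \<and> f j = x} = unit_vec n ` ?J"
    by auto
  ultimately show ?thesis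
    by (auto simp: eigenspace_mat_diag)
qed

text \<open>Injectivity of \<open>k\<close> reduces the indicator to \<open>l = j\<close>, and there
  the exponent \<alpha> \<open>l\<close> + \<alpha> \<open>j\<close> doubles.\<close>

lemma subcritical_cov_eq_mat_diag:
  assumes "inj_on k {..<n}"
  shows "subcritical_cov D n k \<alpha> =
    mat_diag n (\<lambda>i. simplex_moment D (k i) (2 * \<alpha> i) / fact (k i + 1))"
  using assms by (intro eq_matI) (auto simp: subcritical_cov_def mat_diag_def inj_on_eq_iff)

theorem theorem5p11:
  fixes n :: nat and k :: "nat \<Rightarrow> nat" and \<alpha> :: "nat \<Rightarrow> real"
    and \<Sigma> :: "real Matrix.mat" and ev :: "nat \<Rightarrow> real"
  assumes "n \<ge> 2"
    and "admissible CARD('d::finite) n k \<alpha>"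
    and "\<forall>i<n. \<forall>j<n. i \<noteq> j \<longrightarrow> k i \<noteq> k j"
    and "\<Sigma> = subcritical_cov TYPE('d) n k \<alpha>"
    and "\<forall>i. ev i = simplex_moment TYPE('d) (k i) (2 * \<alpha> i) / fact (k i + 1)"
  shows
    "Determinant.det \<Sigma> = (\<Prod>i<n. simplex_moment TYPE('d) (k i) (2 * \<alpha> i) / fact (k i + 1)) \<and>
     ((\<forall>i<n. \<Sigma> $$ (i, i) = ev i) \<and>
      {x. eigenvalue \<Sigma> x} = ev ` {..<n} \<and>
      char_poly \<Sigma> = (\<Prod>i<n. [:- ev i, 1:])) \<and>
     ((\<forall>i<n. (\<forall>j<n. j \<noteq> i \<longrightarrow> ev j \<noteq> ev i) \<longrightarrow>
         eigenspace (ev i) \<Sigma> = vec_span n {unit_vec n i}) \<and>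
      (\<forall>i<n. eigenspace (ev i) \<Sigma> = vec_span n {unit_vec n j |j. j < n \<and> ev j = ev i}))"
proof -
  have "inj_on k {..<n}"
    using assms(3) by (auto simp: inj_on_def)
  moreover have "ev = (\<lambda>i. simplex_moment TYPE('d) (k i) (2 * \<alpha> i) / fact (k i + 1))"
    using assms(5) by auto
  ultimately have \<Sigma>: "\<Sigma> = mat_diag n ev"
    using assms(4) by (simp add: subcritical_cov_eq_mat_diag)
  \<comment> \<open>For a simple eigenvalue the spanning set is a singleton, so the one-vector form
    of the eigenspace is a case of the general one.\<close>
  have "{unit_vec n j :: real Matrix.vec |j. j < n \<and> ev j = ev i} = {unit_vec n i}"
    if "i < n" "\<forall>j<n. j \<noteq> i \<longrightarrow> ev j \<noteq> ev i" for i
    using that by auto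
  then show ?thesis
    \<comment> \<open>Folds the explicit quotients in the determinant formula back into
      \<open>ev\<close>.\<close>
    unfolding assms(5)[rule_format, symmetric] \<Sigma>
    by (simp add: det_mat_diag char_poly_mat_diag eigenvalue_mat_diag_iff
        eigenspace_mat_diag_eq_span)
qed

end
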